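(* Let $u\in\mathbb M$ and let $k$ be an index of the list $r$ of labeled polynomials. If the polynomial multiple $u\,\mathrm{Poly}(k)$ satisfies Faugère's criterion with respect to $G_{\mathrm{prev}}$, then $u\,\mathrm{Sig}(k)$ is not the minimal signature (with respect to $F$) of $u\,\mathrm{Poly}(k)$.
   Context: $\mathcal R=\mathbb F[x_1,\dots,x_n]$ over a field $\mathbb F$; $\mathbb M$ is the set of monomials (power products without coefficient); $<_T$ is a fixed admissible monomial ordering; $\mathrm{HM}(p)$ is the head monomial of $p\neq0$. Fix $F=(f_1,\dots,f_m)\in\mathcal R^m$. An $F$-representation of $p$ is $\mathbf h\in\mathcal R^m$ with $p=h_1f_1+\dots+h_mf_m$. A pair $(\tau,\nu)\in\mathbb M\times\mathbb N$, written $\tau\mathbf F_\nu$, is a signature of $p$ (with respect to $F$) if $p$ has an $F$-representation $\mathbf h$ with $h_{\nu+1}=\dots=h_m=0$, $h_\nu\neq0$ and $\mathrm{HM}(h_\nu)=\tau$; $\nu$ is its index. The zero polynomial $0f_1+\dots+0f_m$ also has the zero signature $\mathbf 0$. Signatures are well-ordered by $\prec$: $\mathbf 0$ is smallest, and $\tau'\mathbf F_a\prec\tau\mathbf F_b$ iff $a<b$, or $a=b$ and $\tau'<_T\tau$. The minimal signature of $p$ is its $\prec$-smallest signature. For $u\in\mathbb M$, $u\cdot\tau\mathbf F_\nu=(u\tau)\mathbf F_\nu$. $r$ is a finite list of labeled polynomials $r_k=(\mathrm{Sig}(k),\mathrm{Poly}(k))$, each admissible with respect to $F$, meaning that $\mathrm{Sig}(k)$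 is a signature of $\mathrm{Poly}(k)$ with respect to $F$. $G_{\mathrm{prev}}$ is a set of indices of elements of $r$ whose polynomials form a Gröbner basis of $\langle f_1,\dots,f_{i-1}\rangle$ for some $i$ (the previously computed basis in the incremental F5 algorithm). The polynomial multiple $u\,\mathrm{Poly}(k)$ satisfies Faugère's criterion with respect to $G_{\mathrm{prev}}$ if, writing $\mathrm{Sig}(k)=\tau\mathbf F_\nu$, there exists $\ell\in G_{\mathrm{prev}}$ such that $\mathrm{Sig}(\ell)=\tau'\mathbf F_{\nu'}$ with $\nu'<\nu$ and $\mathrm{HM}(\mathrm{Poly}(\ell))$ divides $u\tau$. *)

theory Defs
  imports Complex_Main "HOL-Library.Poly_Mapping"
begin

text \<open>
  The index type \<open>'n\<close> is the set of variables (it is constrained to be finite where the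
  polynomial ring in finitely many variables is meant). Monomials are exponent vectors, so
  the product of two monomials is their sum and the monomial 1 is \<open>0\<close>.
\<close>

type_synonym 'n monomial = "'n \<Rightarrow>\<^sub>0 nat"
type_synonym ('n, 'a) polynomial = "'n monomial \<Rightarrow>\<^sub>0 'a"

definition monomial_dvd :: "'n monomial \<Rightarrow> 'n monomial \<Rightarrow> bool" where
  "monomial_dvd s t \<longleftrightarrow> (\<exists>w. t = s + w)"

definition monomial_mult ::
    "'n monomial \<Rightarrow> ('n, 'a::comm_ring_1) polynomial \<Rightarrow> ('n, 'a) polynomial" where
  "monomial_mult u p = Poly_Mapping.single u 1 * p"

definition admissible_ordering :: "('n monomial \<Rightarrow> 'n monomial \<Rightarrow> bool) \<Rightarrow> bool" where
  "admissible_ordering lt \<longleftrightarrow>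
     irreflp lt \<and> transp lt \<and> totalp lt \<and>
     (\<forall>t. t \<noteq> 0 \<longrightarrow> lt 0 t) \<and>
     (\<forall>s t u. lt s t \<longrightarrow> lt (u + s) (u + t))"

text \<open>The head monomial is meaningful for nonzero polynomials only.\<close>

definition HM ::
    "('n monomial \<Rightarrow> 'n monomial \<Rightarrow> bool) \<Rightarrow> ('n, 'a::zero) polynomial \<Rightarrow> 'n monomial" where
  "HM lt p = (THE t. t \<in> Poly_Mapping.keys p \<and> (\<forall>s\<in>Poly_Mapping.keys p. s \<noteq> t \<longrightarrow> lt s t))"

text \<open>The ring viewed as a module over itself: the span of a set is the ideal it generates.\<close>

definition ideal_gen :: "'r::comm_ring_1 set \<Rightarrow> 'r set" where
  "ideal_gen B = module.span (*) B"

definition groebner_basis ::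
    "('n monomial \<Rightarrow> 'n monomial \<Rightarrow> bool) \<Rightarrow> ('n, 'a::comm_ring_1) polynomial set \<Rightarrow>
     ('n, 'a) polynomial set \<Rightarrow> bool" where
  "groebner_basis lt G I \<longleftrightarrow>
     finite G \<and> G \<subseteq> I \<and>
     (\<forall>p\<in>I. p \<noteq> 0 \<longrightarrow> (\<exists>g\<in>G. g \<noteq> 0 \<and> monomial_dvd (HM lt g) (HM lt p)))"

text \<open>
  A tuple of length \<open>m\<close> is a function on \<^typ>\<open>nat\<close> of which only the values at
  \<open>1, ..., m\<close> are used.
\<close>

definition representation ::
    "nat \<Rightarrow> (nat \<Rightarrow> 'r::comm_ring_1) \<Rightarrow> (nat \<Rightarrow> 'r) \<Rightarrow> 'r \<Rightarrow> bool" where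
  "representation m f h p \<longleftrightarrow> p = (\<Sum>j=1..m. h j * f j)"

datatype 'n signature = ZeroSig | MonSig "'n monomial" nat

fun is_signature ::
    "('n monomial \<Rightarrow> 'n monomial \<Rightarrow> bool) \<Rightarrow> nat \<Rightarrow> (nat \<Rightarrow> ('n, 'a::comm_ring_1) polynomial) \<Rightarrow>
     ('n, 'a) polynomial \<Rightarrow> 'n signature \<Rightarrow> bool" where
  "is_signature lt m f p ZeroSig \<longleftrightarrow> p = 0"
| "is_signature lt m f p (MonSig \<tau> \<nu>) \<longleftrightarrow>
     \<nu> \<in> {1..m} \<and>
     (\<exists>h. representation m f h p \<and> (\<forall>j\<in>{\<nu><..m}. h j = 0) \<and> h \<nu> \<noteq> 0 \<and> HM lt (h \<nu>) = \<tau>)"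

fun sig_less ::
    "('n monomial \<Rightarrow> 'n monomial \<Rightarrow> bool) \<Rightarrow> 'n signature \<Rightarrow> 'n signature \<Rightarrow> bool" where
  "sig_less lt ZeroSig (MonSig \<tau> b) \<longleftrightarrow> True"
| "sig_less lt (MonSig \<tau>' a) (MonSig \<tau> b) \<longleftrightarrow> a < b \<or> a = b \<and> lt \<tau>' \<tau>"
| "sig_less lt \<sigma> ZeroSig \<longleftrightarrow> False"

definition is_minimal_signature ::
    "('n monomial \<Rightarrow> 'n monomial \<Rightarrow> bool) \<Rightarrow> nat \<Rightarrow> (nat \<Rightarrow> ('n, 'a::comm_ring_1) polynomial) \<Rightarrow>
     ('n, 'a) polynomial \<Rightarrow> 'n signature \<Rightarrow> bool" where
  "is_minimal_signature lt m f p \<sigma> \<longleftrightarrow>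
     is_signature lt m f p \<sigma> \<and>
     (\<forall>\<sigma>'. is_signature lt m f p \<sigma>' \<and> \<sigma>' \<noteq> \<sigma> \<longrightarrow> sig_less lt \<sigma> \<sigma>')"

fun sig_mult :: "'n monomial \<Rightarrow> 'n signature \<Rightarrow> 'n signature" where
  "sig_mult u ZeroSig = ZeroSig"
| "sig_mult u (MonSig \<tau> \<nu>) = MonSig (u + \<tau>) \<nu>"

type_synonym ('n, 'a) labeled_polynomial = "'n signature \<times> ('n, 'a) polynomial"

definition Sig :: "('n, 'a::zero) labeled_polynomial list \<Rightarrow> nat \<Rightarrow> 'n signature" where
  "Sig r k = fst (r ! k)"

definition Poly :: "('n, 'a::zero) labeled_polynomial list \<Rightarrow> nat \<Rightarrow> ('n, 'a) polynomial" where
  "Poly r k = snd (r ! k)"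

definition admissible_labeled ::
    "('n monomial \<Rightarrow> 'n monomial \<Rightarrow> bool) \<Rightarrow> nat \<Rightarrow> (nat \<Rightarrow> ('n, 'a::comm_ring_1) polynomial) \<Rightarrow>
     ('n, 'a) labeled_polynomial \<Rightarrow> bool" where
  "admissible_labeled lt m f lp \<longleftrightarrow> is_signature lt m f (snd lp) (fst lp)"

text \<open>
  The condition on head monomials presupposes that the polynomial is nonzero, and that the
  two signatures involved are not the zero signature.
\<close>

definition faugere_criterion ::
    "('n monomial \<Rightarrow> 'n monomial \<Rightarrow> bool) \<Rightarrow> ('n, 'a::zero) labeled_polynomial list \<Rightarrow> nat set \<Rightarrow>
     'n monomial \<Rightarrow> nat \<Rightarrow> bool" where
  "faugere_criterion lt r G u k \<longleftrightarrow>
     (\<exists>\<tau> \<nu>. Sig r k = MonSig \<tau> \<nu> \<and>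
       (\<exists>l\<in>G. \<exists>\<tau>' \<nu>'. Sig r l = MonSig \<tau>' \<nu>' \<and> \<nu>' < \<nu> \<and>
          Poly r l \<noteq> 0 \<and> monomial_dvd (HM lt (Poly r l)) (u + \<tau>)))"

end

theory Submission imports Defs
begin

text \<open>
  If \<open>\<tau> \<F>\<^sub>\<nu>\<close> labels \<open>p\<close> and \<open>g = Poly(\<ell>)\<close> has a representation \<open>h'\<close> of index below \<open>\<nu>\<close>, then
  \<open>g f\<^sub>\<nu> - \<Sum>\<^sub>j (h'\<^sub>j f\<^sub>\<nu>) f\<^sub>j = 0\<close> is a principal syzygy whose leading component \<open>g\<close> has index \<open>\<nu>\<close>.
  Faugere's criterion says that a monomial multiple of this syzygy has the head monomial
  \<open>u \<tau>\<close> in component \<open>\<nu>\<close>, so subtracting it from \<open>u\<close> times the representation of \<open>p\<close> cancels the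
  head and leaves a representation of \<open>u p\<close> with a strictly smaller signature.
\<close>

text \<open>Cancellation in the exponent monoid leaves a single nonzero term of the convolution:
  \<open>u + t = u + q\<close> forces \<open>q = t\<close>.\<close>

lemma lookup_single_times_add:
  fixes p :: "('m::cancel_comm_monoid_add) \<Rightarrow>\<^sub>0 ('a::semiring_0)"
  shows "Poly_Mapping.lookup (Poly_Mapping.single u c * p) (u + t) = c * Poly_Mapping.lookup p t"
proof -
  have "Poly_Mapping.lookup (Poly_Mapping.single u c * p) (u + t) =
      (\<Sum>s. (c * (\<Sum>q. Poly_Mapping.lookup p q when u + t = s + q)) when u = s)"
    unfolding lookup_mult lookup_single when_mult ..
  also have "\<dots> = c * (\<Sum>q. Poly_Mapping.lookup p q when t = q)"
    unfolding Sum_any_when_equal' add_left_cancel ..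
  finally show ?thesis
    unfolding Sum_any_when_equal' .
qed

lemma keys_single_times_subset:
  fixes p :: "('m::monoid_add) \<Rightarrow>\<^sub>0 ('a::semiring_0)"
  shows "Poly_Mapping.keys (Poly_Mapping.single u c * p) \<subseteq> (+) u ` Poly_Mapping.keys p"
  using keys_mult[of "Poly_Mapping.single u c" p] by (fastforce split: if_splits)

text \<open>Justifies the definite description in \<open>HM\<close>, applied to the finite nonempty
  key set of a nonzero polynomial.\<close>

lemma finite_strict_total_greatest:
  assumes "irreflp lt" and "transp lt" and "totalp lt" and "finite A" and "A \<noteq> {}"
  shows "\<exists>!t. t \<in> A \<and> (\<forall>s\<in>A. s \<noteq> t \<longrightarrow> lt s t)"
proof -
  obtain t where t: "t \<in> A" "\<forall>s\<in>A. s \<noteq> t \<longrightarrow> lt s t"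
    using assms(4,5)
  proof (induction A arbitrary: thesis rule: finite_ne_induct)
    case (singleton x)
    then show ?case by simp
  next
    case (insert x A)
    obtain t where t: "t \<in> A" "\<forall>s\<in>A. s \<noteq> t \<longrightarrow> lt s t"
      using insert.IH by blast
    consider "lt x t" | "lt t x"
      using totalpD[OF assms(3), of x t] t(1) insert.hyps by blast
    then show ?case
    proof cases
      case 1
      then show ?thesis using t insert.prems[of t] by blast
    next
      case 2
      then have "lt s x" if "s \<in> A" for s
        using t(2) that transpD[OF assms(2), of s t x] by (cases "s = t") auto
      then show ?thesis using insert.prems[of x] by blast
    qed
  qed
  moreover have "y = t" if "y \<in> A" "\<forall>s\<in>A. s \<noteq> y \<longrightarrow> lt s y" for y
    using that t transpD[OF assms(2)] irreflpD[OF assms(1)] by metis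
  ultimately show ?thesis by blast
qed

lemma HM_in_keys_and_greatest:
  assumes "admissible_ordering lt" and "p \<noteq> 0"
  shows "HM lt p \<in> Poly_Mapping.keys p \<and> (\<forall>s\<in>Poly_Mapping.keys p. s \<noteq> HM lt p \<longrightarrow> lt s (HM lt p))"
  unfolding HM_def
  by (rule theI', rule finite_strict_total_greatest)
    (use assms in \<open>auto simp: admissible_ordering_def\<close>)

lemma HM_in_keys:
  "admissible_ordering lt \<Longrightarrow> p \<noteq> 0 \<Longrightarrow> HM lt p \<in> Poly_Mapping.keys p"
  using HM_in_keys_and_greatest by blast

lemma lt_HM:
  "admissible_ordering lt \<Longrightarrow> s \<in> Poly_Mapping.keys p \<Longrightarrow> s \<noteq> HM lt p \<Longrightarrow> lt s (HM lt p)"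
  using HM_in_keys_and_greatest[of lt p] by fastforce

lemma sig_less_asym:
  assumes "admissible_ordering lt" and "sig_less lt \<sigma> \<sigma>'"
  shows "\<not> sig_less lt \<sigma>' \<sigma>"
proof -
  have "\<not> (lt s t \<and> lt t s)" for s t
    using assms(1) by (metis admissible_ordering_def irreflpD transpD)
  then show ?thesis
    using assms(2) by (cases \<sigma>; cases \<sigma>') auto
qed

lemma sig_less_irrefl: "admissible_ordering lt \<Longrightarrow> \<not> sig_less lt \<sigma> \<sigma>"
  using sig_less_asym by blast

lemma not_minimal_signature:
  assumes "admissible_ordering lt" and "is_signature lt m f p \<sigma>'" and "sig_less lt \<sigma>' \<sigma>"
  shows "\<not> is_minimal_signature lt m f p \<sigma>"
  using assms sig_less_asym sig_less_irrefl unfolding is_minimal_signature_def by metis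

text \<open>The ratio \<open>c\<close> makes both products carry the same coefficient at their
  common head, which therefore cancels. Every other key is a translate of a non-head key, and
  translation preserves the ordering.\<close>

lemma keys_lt_head_cancel:
  fixes p q :: "('n, 'a::field) polynomial"
  assumes adm: "admissible_ordering lt" and "p \<noteq> 0" and "q \<noteq> 0"
    and eq: "u + HM lt p = w + HM lt q"
    and c: "c = Poly_Mapping.lookup p (HM lt p) / Poly_Mapping.lookup q (HM lt q)"
    and s: "s \<in> Poly_Mapping.keys (Poly_Mapping.single u 1 * p - Poly_Mapping.single w c * q)"
  shows "lt s (u + HM lt p)"
proof -
  have shift: "lt (v + t) (v + HM lt x)" if "t \<in> Poly_Mapping.keys x" "t \<noteq> HM lt x"
    for v t and x :: "('n, 'a) polynomial"
    using adm lt_HM[OF adm that(1)] that(2) by (auto simp: admissible_ordering_def)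
  have "Poly_Mapping.lookup q (HM lt q) \<noteq> 0"
    using HM_in_keys[OF adm \<open>q \<noteq> 0\<close>] by (simp add: in_keys_iff)
  then have "Poly_Mapping.lookup (Poly_Mapping.single u 1 * p - Poly_Mapping.single w c * q)
      (u + HM lt p) = 0"
    using lookup_single_times_add[of w c q "HM lt q"]
    by (simp add: lookup_minus lookup_single_times_add c flip: eq)
  then have "s \<noteq> u + HM lt p"
    using s by (auto simp: in_keys_iff)
  moreover have "s \<in> (+) u ` Poly_Mapping.keys p \<union> (+) w ` Poly_Mapping.keys q"
    using s keys_diff keys_single_times_subset by fast
  \<comment> \<open>In both cases \<open>t\<close> is not the head, since \<open>s\<close> differs
    from the common value \<open>u + HM lt p = w + HM lt q\<close>.\<close>
  ultimately consider t where "s = u + t" "t \<in> Poly_Mapping.keys p" "t \<noteq> HM lt p"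
    | t where "s = w + t" "t \<in> Poly_Mapping.keys q" "t \<noteq> HM lt q"
    using eq by auto
  then show ?thesis
  proof cases
    case 1
    then show ?thesis using shift[of t p u] by simp
  next
    case 2
    then show ?thesis using shift[of t q w] eq by simp
  qed
qed

text \<open>Component \<nu> may be zero, so the signature is read off at the last nonzero component
  \<mu>; if there is none, the polynomial is 0 and has the zero signature.\<close>

lemma exists_smaller_signature:
  assumes adm: "admissible_ordering lt" and rep: "representation m f h p"
    and "\<nu> \<in> {1..m}" and zero: "\<forall>j\<in>{\<nu><..m}. h j = 0"
    and small: "\<And>s. s \<in> Poly_Mapping.keys (h \<nu>) \<Longrightarrow> lt s \<tau>"
  shows "\<exists>\<sigma>. is_signature lt m f p \<sigma> \<and> sig_less lt \<sigma> (MonSig \<tau> \<nu>)"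
proof (cases "\<forall>j\<in>{1..m}. h j = 0")
  case True
  then have "is_signature lt m f p ZeroSig"
    using rep by (simp add: representation_def)
  then show ?thesis
    using sig_less.simps(1) by blast
next
  case False
  define N where "N = {j\<in>{1..m}. h j \<noteq> 0}"
  define \<mu> where "\<mu> = Max N"
  have N: "finite N" "N \<noteq> {}"
    using False by (auto simp: N_def)
  have \<mu>: "\<mu> \<in> {1..m}" "h \<mu> \<noteq> 0"
    using Max_in[OF N] by (auto simp: N_def \<mu>_def)
  have above: "\<forall>j\<in>{\<mu><..m}. h j = 0"
    using Max_ge[OF N(1)] \<mu>(1) by (fastforce simp: N_def \<mu>_def)
  have "\<mu> \<le> \<nu>"
    using \<mu> zero by (meson atLeastAtMost_iff greaterThanAtMost_iff not_le)
  \<comment> \<open>For \<mu> < \<nu> the index decides; for \<mu> = \<nu> the head of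
    \<open>h \<mu>\<close> is a key of \<open>h \<nu>\<close>, hence below \<tau>.\<close>
  then have "sig_less lt (MonSig (HM lt (h \<mu>)) \<mu>) (MonSig \<tau> \<nu>)"
    using small HM_in_keys[OF adm \<mu>(2)] by (cases "\<mu> = \<nu>") auto
  moreover have "is_signature lt m f p (MonSig (HM lt (h \<mu>)) \<mu>)"
    using rep above \<mu> by auto
  ultimately show ?thesis by blast
qed

text \<open>The tuple multiplied by \<open>b\<close> is the principal syzygy: it contributes
  \<open>g * f \<nu>\<close> minus \<open>f \<nu>\<close> times the representation of
  \<open>g\<close>, that is, 0.\<close>

lemma representation_add_principal_syzygy:
  assumes "representation m f h p" and "representation m f h' g" and "\<nu> \<in> {1..m}"
  shows "representation m f (\<lambda>j. a * h j - b * ((if j = \<nu> then g else 0) - h' j * f \<nu>)) (a * p)"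
proof -
  have "(\<Sum>j=1..m. (a * h j - b * ((if j = \<nu> then g else 0) - h' j * f \<nu>)) * f j) =
      (\<Sum>j=1..m. a * (h j * f j) - b * (if j = \<nu> then g * f \<nu> else 0) + b * f \<nu> * (h' j * f j))"
    by (rule sum.cong) (auto simp: algebra_simps)
  also have "\<dots> = a * (\<Sum>j=1..m. h j * f j) - b * (\<Sum>j=1..m. if j = \<nu> then g * f \<nu> else 0)
      + b * f \<nu> * (\<Sum>j=1..m. h' j * f j)"
    by (simp only: sum.distrib sum_subtractf sum_distrib_left)
  also have "(\<Sum>j=1..m. if j = \<nu> then g * f \<nu> else 0) = g * f \<nu>"
    using assms(3) by simp
  also have "a * (\<Sum>j=1..m. h j * f j) - b * (g * f \<nu>) + b * f \<nu> * (\<Sum>j=1..m. h' j * f j) = a * p"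
    using assms(1,2) by (simp add: representation_def algebra_simps)
  finally show ?thesis
    by (simp add: representation_def)
qed

theorem proposition23:
  fixes lt :: "('n::finite) monomial \<Rightarrow> 'n monomial \<Rightarrow> bool"
    and m :: nat
    and f :: "nat \<Rightarrow> ('n, 'a::field) polynomial"
    and r :: "('n, 'a) labeled_polynomial list"
    and G_prev :: "nat set"
    and i k :: nat
    and u :: "'n monomial"
  assumes "admissible_ordering lt"
    and "\<forall>lp\<in>set r. admissible_labeled lt m f lp"
    and "G_prev \<subseteq> {..<length r}"
    and "1 \<le> i" and "i \<le> m + 1"
    and "groebner_basis lt (Poly r ` G_prev) (ideal_gen (f ` {1..i - 1}))"
    and "k < length r"
    and "faugere_criterion lt r G_prev u k"
  shows "\<not> is_minimal_signature lt m f (monomial_mult u (Poly r k)) (sig_mult u (Sig r k))"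
proof -
  note adm = assms(1)
  have labeled: "is_signature lt m f (Poly r j) (Sig r j)" if "j < length r" for j
    using assms(2) that by (simp add: admissible_labeled_def Poly_def Sig_def)
  obtain \<tau> \<nu> l \<tau>' \<nu>' w where Sk: "Sig r k = MonSig \<tau> \<nu>" and l: "l \<in> G_prev"
    and Sl: "Sig r l = MonSig \<tau>' \<nu>'" and less: "\<nu>' < \<nu>" and g: "Poly r l \<noteq> 0"
    and w: "u + \<tau> = HM lt (Poly r l) + w"
    using assms(8) unfolding faugere_criterion_def monomial_dvd_def by blast
  obtain h where \<nu>: "\<nu> \<in> {1..m}" and h: "representation m f h (Poly r k)"
    and h0: "\<forall>j\<in>{\<nu><..m}. h j = 0" and h\<nu>: "h \<nu> \<noteq> 0" and \<tau>: "HM lt (h \<nu>) = \<tau>"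
    using labeled[OF assms(7)] Sk by auto
  obtain h' where h': "representation m f h' (Poly r l)" and h'0: "\<forall>j\<in>{\<nu>'<..m}. h' j = 0"
    using labeled[of l] l assms(3) Sl by auto
  \<comment> \<open>The quotient of the head coefficients, with the cofactor \<open>w\<close> from
    the divisibility, scales the syzygy so that its component \<nu> has the same head term as
    \<open>u\<close> times \<open>h \<nu>\<close>.\<close>
  define c where "c = Poly_Mapping.lookup (h \<nu>) (HM lt (h \<nu>)) /
    Poly_Mapping.lookup (Poly r l) (HM lt (Poly r l))"
  define H where "H = (\<lambda>j. Poly_Mapping.single u 1 * h j -
    Poly_Mapping.single w c * ((if j = \<nu> then Poly r l else 0) - h' j * f \<nu>))"
  have rep: "representation m f H (monomial_mult u (Poly r k))"
    unfolding H_def monomial_mult_def by (rule representation_add_principal_syzygy[OF h h' \<nu>])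
  \<comment> \<open>As \<nu>' < \<nu>, \<open>h'\<close> vanishes from \<nu> on: the syzygy adds
    nothing beyond \<nu>, and its component at \<nu> is exactly \<open>Poly r l\<close>.\<close>
  have "\<forall>j\<in>{\<nu><..m}. H j = 0"
    using h0 h'0 less by (simp add: H_def)
  moreover have "H \<nu> = Poly_Mapping.single u 1 * h \<nu> - Poly_Mapping.single w c * Poly r l"
    using h'0 less \<nu> by (simp add: H_def)
  then have "lt s (u + \<tau>)" if "s \<in> Poly_Mapping.keys (H \<nu>)" for s
    using keys_lt_head_cancel[OF adm h\<nu> g _ c_def, of u w s] w \<tau> that by (simp add: add.commute)
  ultimately obtain \<sigma> where "is_signature lt m f (monomial_mult u (Poly r k)) \<sigma>"
    and "sig_less lt \<sigma> (MonSig (u + \<tau>) \<nu>)"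
    using exists_smaller_signature[OF adm rep \<nu>] by blast
  then show ?thesis
    using not_minimal_signature[OF adm] Sk by simp
qed

end
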